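(* Let $k$ be an integer. Let $c_0,c_1,\ldots\in\mathbb{Q}$ be given, and define $b_j\in\mathbb{Q}$ for $j\ge 0$ by $$b_j=(k-1)^j+c_j+(-1)^{j+1}\sum_{i=0}^{j}\binom{j}{i}c_i .$$ Fix an odd prime $p$ which does not divide the denominator of any $c_i$, and let $N$ be a non-negative integer. Define $$E_N:=\binom{kp-1}{p-1}-\sum_{j=0}^{N}b_j\,p^jH(\{1\}^j;p-1).$$ (i) If $0\le N\le p-4$, then $$E_N\equiv \frac{-B_{p-3-N}}{N+3}\left(\frac{N+2}{2}b_{N+1}+b_{N+2}\right)p^{N+3}\pmod{p^{N+4}}$$ when $N$ is even, and $$E_N\equiv\frac{-B_{p-2-N}}{N+2}\,b_{N+1}\,p^{N+2}\pmod{p^{N+3}}$$ when $N$ is odd. (ii) If $N=p-3$, then $E_N\equiv\left(\frac{b_{N+1}}{2}-b_{N+2}\right)p^{N+2}\pmod{p^{N+3}}$. (iii) If $N=p-2$, then $E_N\equiv -b_{N+1}p^{N+1}\pmod{p^{N+2}}$. (iv) If $N\ge p-1$, then $E_N=0$. In particular, the congruence $$\binom{kp-1}{p-1}\equiv\sum_{j=0}^{N}b_j\,p^jH(\{1\}^j;p-1)$$ holds modulo $p^{N+3}$ if $N\le p-4$ and $N$ is even; modulo $p^{N+2}$ if $N\le p-4$ and $N$ is odd; modulo $p^{N+2}$ if $N=p-3$; modulo $p^{N+1}$ if $N=p-2$; and is an equality if $N\ge p-1$.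
   Context: For non-negative integers $j,m$, the elementary symmetric multiple harmonic sum is $H(\{1\}^j;m)=\sum_{m\ge i_1>i_2>\cdots>i_j\ge 1}\frac{1}{i_1 i_2\cdots i_j}\in\mathbb{Q}$, with $H(\{1\}^0;m)=1$ and $H(\{1\}^j;m)=0$ if $j>m$. For an arbitrary integer $x$, $\binom{x}{m}=x(x-1)\cdots(x-m+1)/m!$. By convention $(k-1)^0=1$. The Bernoulli numbers are given by $\frac{t}{e^t-1}=\sum_{m\ge0}B_m\frac{t^m}{m!}$. Congruences modulo $p^m$ are between rational numbers with denominators prime to $p$: $x\equiv y\pmod{p^m}$ means $x-y$ has $p$-adic valuation at least $m$. *)

theory Defs
  imports Complex_Main "HOL-Computational_Algebra.Computational_Algebra"
begin

(* H({1}^j; m): a list in the index set is a tuple i_1 > i_2 > ... > i_j of elements of {1..m}.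
   For j = 0 only the empty list occurs (value 1); for j > m there is none (value 0). *)
definition elem_harmonic :: "nat \<Rightarrow> nat \<Rightarrow> rat" where
  "elem_harmonic j m =
     (\<Sum>is | length is = j \<and> sorted_wrt (>) is \<and> set is \<subseteq> {1..m}. \<Prod>i\<leftarrow>is. 1 / of_nat i)"

(* t / (e^t - 1) = sum of B_m t^m / m!, hence B_1 = -1/2. The quotient of formal power series
   cancels the common factor t, see bernoulli_gf below. *)
definition bernoulli :: "nat \<Rightarrow> rat" where
  "bernoulli m = fact m * fps_nth (fps_X / (fps_exp 1 - 1)) m"

lemma bernoulli_gf:
  "Abs_fps (\<lambda>m. bernoulli m / fact m) * (fps_exp 1 - 1) = (fps_X :: rat fps)"
proof -
  have eq: "Abs_fps (\<lambda>m. bernoulli m / fact m) = (fps_X :: rat fps) / (fps_exp 1 - 1)"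
    by (simp add: fps_eq_iff bernoulli_def)
  have n1: "fps_nth (fps_exp 1 - 1 :: rat fps) 1 \<noteq> 0" by simp
  then have nz: "(fps_exp 1 - 1 :: rat fps) \<noteq> 0"
    by (metis fps_zero_nth)
  have "subdegree (fps_exp 1 - 1 :: rat fps) \<le> 1"
    using n1 by (rule subdegree_leI)
  then have "(fps_exp 1 - 1 :: rat fps) dvd fps_X"
    using nz by (simp add: fps_dvd_iff)
  then show ?thesis
    unfolding eq by simp
qed

definition p_integral :: "nat \<Rightarrow> rat \<Rightarrow> bool" where
  "p_integral p x \<longleftrightarrow> \<not> int p dvd snd (quotient_of x)"

(* Meaningful for x \<noteq> 0 only; the valuation of 0 is infinite, which rat_cong treats separately. *)
definition padic_val :: "nat \<Rightarrow> rat \<Rightarrow> int" where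
  "padic_val p x = int (multiplicity (int p) (fst (quotient_of x)))
                 - int (multiplicity (int p) (snd (quotient_of x)))"

(* x \<equiv> y modulo p^m; it includes the requirement that both sides have denominators prime to p. *)
definition rat_cong :: "nat \<Rightarrow> nat \<Rightarrow> rat \<Rightarrow> rat \<Rightarrow> bool" where
  "rat_cong p m x y \<longleftrightarrow>
     p_integral p x \<and> p_integral p y \<and> (x = y \<or> padic_val p (x - y) \<ge> int m)"

end

theory Submission
  imports Defs "HOL-Combinatorics.Stirling" "HOL-Number_Theory.Residues"
begin

hide_const (open) up_ring.coeff

text \<open>
  Put \<open>F(x) = (x + 1) \<dots> (x + p - 1)\<close>. Its coefficients are Stirling numbers of the first kind, and
  \<open>F(x) / (p - 1)! = \<Sum> H({1}^j; p - 1) x^j\<close>; the binomial coefficient is the value of this at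
  \<open>x = (k - 1) p\<close>. Since \<open>p\<close> is odd, \<open>F(- p - x) = F(x)\<close>, and comparing coefficients gives linear
  relations between the numbers \<open>p^j H({1}^j; p - 1)\<close>. Weighting these relations by \<open>c\<close> turns the
  coefficients \<open>(k - 1)^j\<close> into \<open>b j\<close>, so the sum up to \<open>p - 1\<close> is exact and \<open>E\<close> is the sum of the terms
  with \<open>N < j < p\<close>.

  For the leading terms, \<open>x F(x) = x (x + 1) \<dots> (x + p - 1)\<close> yields Lagrange's recurrence for the elementary
  symmetric functions of \<open>1, \<dots>, p - 1\<close>. Modulo \<open>p^2\<close> it becomes the recurrence of the Bernoulli
  numbers, which determines \<open>H({1}^j; p - 1)\<close> modulo \<open>p^2\<close> for even \<open>j\<close>. For odd \<open>j\<close> the symmetry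
  expresses \<open>H({1}^j; p - 1)\<close> modulo \<open>p^3\<close> by \<open>H({1}^(j+1); p - 1)\<close>.
\<close>

subsection \<open>Arithmetic of p-integral rationals\<close>

text \<open>The reduced denominator divides the denominator of any other representation, so a
  fraction not in lowest terms suffices to certify integrality. The closure rules below rest on
  this.\<close>

lemma p_integral_iff:
  assumes "prime p"
  shows "p_integral p x \<longleftrightarrow> (\<exists>a b :: int. \<not> int p dvd b \<and> x = of_int a / of_int b)"
proof
  assume "p_integral p x"
  then show "\<exists>a b :: int. \<not> int p dvd b \<and> x = of_int a / of_int b"
    unfolding p_integral_def by (metis prod.collapse quotient_of_div)
next
  assume "\<exists>a b :: int. \<not> int p dvd b \<and> x = of_int a / of_int b"
  then obtain a b where ab: "\<not> int p dvd b" "x = of_int a / of_int b" by blast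
  obtain u v where uv: "quotient_of x = (u, v)" by (cases "quotient_of x")
  then have v: "v > 0" "coprime u v" "x = of_int u / of_int v"
    by (auto dest: quotient_of_denom_pos quotient_of_coprime quotient_of_div)
  have "b \<noteq> 0" using ab by auto
  then have "(of_int (a * v) :: rat) = of_int (u * b)" using v ab by (simp add: field_simps)
  then have "a * v = u * b" by (simp only: of_int_eq_iff)
  then have "v dvd u * b" by (metis dvd_triv_right)
  then have "v dvd b" using v(2) by (metis coprime_commute coprime_dvd_mult_right_iff)
  then show "p_integral p x" unfolding p_integral_def uv using ab(1) by (auto intro: dvd_trans)
qed

locale p_adic =
  fixes p :: nat
  assumes prime: "prime p"
begin

lemma prime_int: "prime (int p)"
  using prime by simp

lemma p_pos: "p > 0"
  using prime by (rule prime_gt_0_nat)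

lemma p_integral_of_int [simp]: "p_integral p (of_int a)"
  unfolding p_integral_def using prime_gt_1_nat[OF prime] by simp

lemma p_integral_of_nat [simp]: "p_integral p (of_nat a)"
  by (metis of_int_of_nat_eq p_integral_of_int)

lemma p_integral_0 [simp]: "p_integral p 0" and p_integral_1 [simp]: "p_integral p 1"
  and p_integral_numeral [simp]: "p_integral p (numeral w)"
  using p_integral_of_int[of 0] p_integral_of_int[of 1] p_integral_of_int[of "numeral w"]
  by (simp_all del: p_integral_of_int)

lemma p_integral_add [intro]:
  assumes "p_integral p x" "p_integral p y" shows "p_integral p (x + y)"
proof -
  obtain a b c d where *: "\<not> int p dvd b" "x = of_int a / of_int b" "\<not> int p dvd d" "y = of_int c / of_int d"
    using assms unfolding p_integral_iff[OF prime] by blast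
  have "\<not> int p dvd b * d" using * prime_int by (simp add: prime_dvd_mult_iff)
  moreover have "x + y = of_int (a * d + c * b) / of_int (b * d)"
  proof -
    have "b \<noteq> 0" "d \<noteq> 0" using * by auto
    then show ?thesis using * by (simp add: field_simps)
  qed
  ultimately show ?thesis unfolding p_integral_iff[OF prime] by blast
qed

lemma p_integral_mult [intro]:
  assumes "p_integral p x" "p_integral p y" shows "p_integral p (x * y)"
proof -
  obtain a b c d where *: "\<not> int p dvd b" "x = of_int a / of_int b" "\<not> int p dvd d" "y = of_int c / of_int d"
    using assms unfolding p_integral_iff[OF prime] by blast
  have "\<not> int p dvd b * d" using * prime_int by (simp add: prime_dvd_mult_iff)
  moreover have "x * y = of_int (a * c) / of_int (b * d)"
    using * by simp
  ultimately show ?thesis unfolding p_integral_iff[OF prime] by blast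
qed

lemma p_integral_minus [intro]: "p_integral p x \<Longrightarrow> p_integral p (- x)"
  using p_integral_mult[of "of_int (-1)" x] by (simp del: of_int_minus) simp

lemma p_integral_diff [intro]: "p_integral p x \<Longrightarrow> p_integral p y \<Longrightarrow> p_integral p (x - y)"
  using p_integral_add[of x "- y"] by auto

lemma p_integral_power [intro]: "p_integral p x \<Longrightarrow> p_integral p (x ^ n)"
  by (induction n) auto

lemma p_integral_sum [intro]: "(\<And>i. i \<in> I \<Longrightarrow> p_integral p (f i)) \<Longrightarrow> p_integral p (sum f I)"
  by (induction I rule: infinite_finite_induct) auto

lemma p_integral_divide_int:
  assumes "p_integral p x" "\<not> int p dvd d" shows "p_integral p (x / of_int d)"
proof -
  have "p_integral p (of_int 1 / of_int d)"
    unfolding p_integral_iff[OF prime] using assms(2) by blast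
  from p_integral_mult[OF assms(1) this] show ?thesis by simp
qed

lemma p_integral_divide_nat:
  assumes "p_integral p x" "\<not> p dvd d" shows "p_integral p (x / of_nat d)"
  using p_integral_divide_int[of x "int d"] assms by simp

text \<open>Divisibility by \<open>p ^ m\<close> in the ring of p-integral rationals. In contrast to
  a bound on \<open>padic_val\<close>, this form covers 0 uniformly and includes integrality, so
  sums and products need no case distinctions.\<close>

definition pdvd :: "nat \<Rightarrow> rat \<Rightarrow> bool" where
  "pdvd m x \<longleftrightarrow> (\<exists>z. p_integral p z \<and> x = of_nat p ^ m * z)"

lemma pdvdI [intro]: "p_integral p z \<Longrightarrow> x = of_nat p ^ m * z \<Longrightarrow> pdvd m x"
  unfolding pdvd_def by blast

lemma pdvd_0 [simp]: "pdvd m 0"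
  by (rule pdvdI[of 0]) auto

lemma pdvd_add: "pdvd m x \<Longrightarrow> pdvd m y \<Longrightarrow> pdvd m (x + y)"
  unfolding pdvd_def by (metis distrib_left p_integral_add)

lemma pdvd_mult: "pdvd m x \<Longrightarrow> pdvd n y \<Longrightarrow> pdvd (m + n) (x * y)"
proof -
  assume "pdvd m x" "pdvd n y"
  then obtain z w where "p_integral p z" "x = of_nat p ^ m * z" "p_integral p w" "y = of_nat p ^ n * w"
    unfolding pdvd_def by blast
  then show ?thesis by (intro pdvdI[of "z * w"]) (auto simp: power_add)
qed

lemma pdvd_0_iff: "pdvd 0 x \<longleftrightarrow> p_integral p x"
  unfolding pdvd_def by auto

lemma pdvd_mult_left: "p_integral p x \<Longrightarrow> pdvd m y \<Longrightarrow> pdvd m (x * y)"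
  using pdvd_mult[of 0 x m y] by (simp add: pdvd_0_iff)

lemma pdvd_minus: "pdvd m x \<Longrightarrow> pdvd m (- x)"
  using pdvd_mult_left[of "of_int (-1)" m x] by (simp del: of_int_minus) simp

lemma pdvd_diff: "pdvd m x \<Longrightarrow> pdvd m y \<Longrightarrow> pdvd m (x - y)"
  using pdvd_add[of m x "- y"] pdvd_minus by auto

lemma pdvd_sum: "(\<And>i. i \<in> I \<Longrightarrow> pdvd m (f i)) \<Longrightarrow> pdvd m (sum f I)"
  by (induction I rule: infinite_finite_induct) (auto intro: pdvd_add)

lemma pdvd_power: "pdvd m (of_nat p ^ m)"
  by (rule pdvdI[of 1]) auto

lemma pdvd_mono: "pdvd n x \<Longrightarrow> m \<le> n \<Longrightarrow> pdvd m x"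
  using pdvd_mult[of m "of_nat p ^ m" "n - m"] pdvd_power unfolding pdvd_def
  by (metis (no_types, lifting) le_add_diff_inverse mult.assoc p_integral_mult p_integral_of_nat p_integral_power power_add)

lemma pdvd_integral: "pdvd m x \<Longrightarrow> p_integral p x"
  using pdvd_mono[of m x 0] by (simp add: pdvd_0_iff)

lemma pdvd_of_int: "int p dvd a \<Longrightarrow> pdvd 1 (of_int a)"
  by (elim dvdE, rule pdvdI[of "of_int _"]) auto

lemma pdvd_of_nat: "p dvd a \<Longrightarrow> pdvd 1 (of_nat a)"
  using pdvd_of_int[of "int a"] by simp

lemma pdvd_divide_nat: "pdvd m x \<Longrightarrow> \<not> p dvd d \<Longrightarrow> pdvd m (x / of_nat d)"
  using pdvd_mult_left[of "1 / of_nat d" m x] p_integral_divide_nat[of 1 d] by simp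

text \<open>Passage from \<open>pdvd\<close> back to the valuation: write the difference as
  \<open>u / v\<close> in lowest terms. Integrality keeps p out of v, and clearing denominators
  shows that \<open>p ^ m\<close> divides u.\<close>

lemma rat_congI:
  assumes "p_integral p y" "pdvd m (x - y)"
  shows "rat_cong p m x y"
proof -
  have "p_integral p x"
    using p_integral_add[OF assms(1) pdvd_integral[OF assms(2)]] by simp
  moreover have "padic_val p (x - y) \<ge> int m" if "x \<noteq> y"
  proof -
    let ?z = "x - y"
    obtain u v where uv: "quotient_of ?z = (u, v)" by (cases "quotient_of ?z")
    then have v: "v > 0" "coprime u v" "?z = of_int u / of_int v"
      by (auto dest: quotient_of_denom_pos quotient_of_coprime quotient_of_div)
    have nv: "\<not> int p dvd v"
      using pdvd_integral[OF assms(2)] uv by (simp add: p_integral_def)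
    obtain w where w: "p_integral p w" "?z = of_nat p ^ m * w"
      using assms(2) unfolding pdvd_def by blast
    obtain c d where cd: "\<not> int p dvd d" "w = of_int c / of_int d"
      using w(1) unfolding p_integral_iff[OF prime] by blast
    have "d \<noteq> 0" using cd by auto
    then have "(of_int (u * d) :: rat) = of_int (int p ^ m * c * v)"
      using v w cd by (simp add: field_simps)
    then have "u * d = int p ^ m * c * v" by (simp only: of_int_eq_iff)
    then have "int p ^ m dvd u * d" by simp
    moreover have "coprime (int p ^ m) d"
      using cd(1) prime_int by (simp add: prime_imp_coprime)
    ultimately have "int p ^ m dvd u" by (simp add: coprime_dvd_mult_left_iff)
    moreover have "u \<noteq> 0" using v(3) that by auto
    ultimately have "m \<le> multiplicity (int p) u"
      using prime_int by (intro multiplicity_geI) auto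
    then show ?thesis
      unfolding padic_val_def uv using nv by (simp add: not_dvd_imp_multiplicity_0)
  qed
  ultimately show ?thesis unfolding rat_cong_def using assms(1) by blast
qed

end

subsection \<open>Harmonic sums, Stirling numbers and Bernoulli numbers\<close>

lemma elem_harmonic_0: "elem_harmonic 0 m = 1"
proof -
  have "{is::nat list. length is = 0 \<and> sorted_wrt (>) is \<and> set is \<subseteq> {1..m}} = {[]}" by auto
  then show ?thesis unfolding elem_harmonic_def by simp
qed

lemma elem_harmonic_Suc_0: "elem_harmonic (Suc j) 0 = 0"
proof -
  have "{is::nat list. length is = Suc j \<and> sorted_wrt (>) is \<and> set is \<subseteq> {1..0}} = {}" by auto
  then show ?thesis unfolding elem_harmonic_def by (simp only: sum.empty)
qed

text \<open>Split the decreasing tuples by whether their first, hence largest, entry is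
  \<open>Suc m\<close>; removing that entry leaves a tuple over \<open>{1..m}\<close>.\<close>

lemma elem_harmonic_Suc_Suc:
  "elem_harmonic (Suc j) (Suc m) = elem_harmonic (Suc j) m + elem_harmonic j m / of_nat (Suc m)"
proof -
  define T where "T j m = {is::nat list. length is = j \<and> sorted_wrt (>) is \<and> set is \<subseteq> {1..m}}" for j m
  define g :: "nat list \<Rightarrow> rat" where "g is = (\<Prod>i\<leftarrow>is. 1 / of_nat i)" for "is"
  have H: "elem_harmonic j m = sum g (T j m)" for j m
    unfolding elem_harmonic_def T_def g_def ..
  have fin: "finite (T j m)" for j m
    by (rule finite_subset[OF _ finite_lists_length_eq[of "{1..m}" j]]) (auto simp: T_def)
  have un: "T (Suc j) (Suc m) = T (Suc j) m \<union> (#) (Suc m) ` T j m"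
  proof (intro equalityI subsetI)
    fix xs assume xs: "xs \<in> T (Suc j) (Suc m)"
    then obtain a ys where ays: "xs = a # ys" by (auto simp: T_def length_Suc_conv)
    have less: "\<forall>y\<in>set ys. y < a \<and> 1 \<le> y" and a: "1 \<le> a" "a \<le> Suc m"
      using xs ays by (auto simp: T_def)
    show "xs \<in> T (Suc j) m \<union> (#) (Suc m) ` T j m"
    proof (cases "a = Suc m")
      case True
      then have "ys \<in> T j m" using xs ays less by (force simp: T_def)
      then show ?thesis using ays True by auto
    next
      case False
      then have "xs \<in> T (Suc j) m" using xs ays less a by (force simp: T_def)
      then show ?thesis by auto
    qed
  next
    fix xs assume "xs \<in> T (Suc j) m \<union> (#) (Suc m) ` T j m"
    then show "xs \<in> T (Suc j) (Suc m)" by (force simp: T_def)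
  qed
  have "sum g (T (Suc j) (Suc m)) = sum g (T (Suc j) m) + sum g ((#) (Suc m) ` T j m)"
    unfolding un by (rule sum.union_disjoint) (use fin in \<open>force simp: T_def\<close>)+
  also have "sum g ((#) (Suc m) ` T j m) = (\<Sum>is\<in>T j m. g (Suc m # is))"
    by (subst sum.reindex) auto
  also have "\<dots> = sum g (T j m) / of_nat (Suc m)"
    unfolding sum_divide_distrib g_def by (intro sum.cong) auto
  finally show ?thesis unfolding H .
qed

text \<open>Multiplying by m! turns the sum of products of j reciprocals into the elementary
  symmetric function of degree m - j of 1, ..., m, an unsigned Stirling number of the first kind.
  The proof matches the two recurrences in m.\<close>

lemma elem_harmonic_conv_stirling:
  "elem_harmonic j m = of_nat (stirling (Suc m) (Suc j)) / fact m"
proof (induction m arbitrary: j)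
  case 0
  then show ?case by (cases j) (simp_all add: elem_harmonic_0 elem_harmonic_Suc_0)
next
  case (Suc m)
  show ?case
  proof (cases j)
    case 0
    have "stirling (Suc (Suc m)) (Suc 0) = fact (Suc m)" by (rule stirling_Suc_n_1)
    then show ?thesis using 0 by (simp only: elem_harmonic_0 of_nat_fact) simp
  next
    case (Suc i)
    have "stirling (Suc (Suc m)) (Suc j) = Suc m * stirling (Suc m) (Suc j) + stirling (Suc m) j"
      by simp
    moreover have "a / f + c / f / q = (q * a + c) / (q * f)" if "f \<noteq> 0" "q \<noteq> 0" for a c f q :: rat
      using that by (simp add: field_simps)
    ultimately show ?thesis
      unfolding Suc elem_harmonic_Suc_Suc Suc.IH fact_Suc
      by (simp only: of_nat_add of_nat_mult fact_nonzero of_nat_neq_0 not_False_eq_True)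
  qed
qed

text \<open>Coefficient of degree \<open>Suc j\<close> in the generating function identity. The
  summand with index \<open>Suc j\<close> drops out because \<open>fps_exp 1 - 1\<close> has no
  constant term; \<open>j > 0\<close> makes the coefficient of \<open>fps_X\<close> zero.\<close>

lemma bernoulli_recurrence:
  assumes "j > 0"
  shows "(\<Sum>i\<le>j. of_nat (Suc j choose i) * bernoulli i) = 0"
proof -
  have "0 = fps_nth (Abs_fps (\<lambda>m. bernoulli m / fact m) * (fps_exp 1 - 1)) (Suc j)"
    unfolding bernoulli_gf using assms by simp
  also have "\<dots> = (\<Sum>i\<le>Suc j. bernoulli i / fact i * fps_nth (fps_exp 1 - 1) (Suc j - i))"
    by (simp add: fps_mult_nth atMost_atLeast0)
  also have "\<dots> = (\<Sum>i\<le>j. bernoulli i / fact i * fps_nth (fps_exp 1 - 1) (Suc j - i))"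
    unfolding sum.atMost_Suc diff_self_eq_0 by (simp only: fps_sub_nth fps_exp_nth) simp
  also have "\<dots> = (\<Sum>i\<le>j. of_nat (Suc j choose i) * bernoulli i) / fact (Suc j)"
    unfolding sum_divide_distrib
    by (rule sum.cong) (simp_all add: binomial_fact mult.commute del: fact_Suc)
  finally show ?thesis by (simp del: fact_Suc)
qed

lemma bernoulli_zero: "bernoulli 0 = 1"
  using arg_cong[OF bernoulli_gf, of "\<lambda>f. fps_nth f 1"] by (simp add: fps_mult_nth)

section \<open>Coefficient identities: Lagrange's recurrence, reflection and the binomial
  expansion\<close>

lemma coeff_linear_power_binomial:
  "coeff ([:a, b:] ^ k) m = of_nat (k choose m) * b ^ m * a ^ (k - m)" for a b :: "'a::comm_ring_1"
proof (cases "m \<le> k")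
  case True
  then show ?thesis by (rule coeff_linear_poly_power)
next
  case False
  have "degree ([:a, b:] ^ k) \<le> degree [:a, b:] * k" by (rule degree_power_le)
  also have "\<dots> \<le> 1 * k" by (rule mult_le_mono1) simp
  finally show ?thesis using False by (simp add: coeff_eq_0 binomial_eq_0)
qed

lemma coeff_of_nat_mult: "coeff (of_nat n * q) i = of_nat n * coeff q i" for q :: "'a::comm_ring_1 poly"
  by (simp add: of_nat_poly)

text \<open>With P(X) = X (X + 1) ... (X + n - 1), compare the coefficients of X^(m+1) in X P(X + 1)
  = (X + n) P(X).\<close>

lemma sum_binomial_stirling:
  "(\<Sum>k\<le>n. (k choose m) * stirling n k) = stirling n m + n * stirling n (Suc m)"
proof -
  define X :: "int poly" where "X = [:0, 1:]"
  have coeff_P: "coeff (pochhammer X n) i = of_nat (stirling n i)" for i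
  proof -
    have "coeff (pochhammer X n) i = (\<Sum>k\<le>n. if k = i then of_nat (stirling n k) else 0)"
      unfolding stirling_pochhammer[symmetric] coeff_sum coeff_of_nat_mult X_def coeff_linear_power_binomial
      by (rule sum.cong) auto
    also have "\<dots> = of_nat (stirling n i)" by (cases "i \<le> n") (simp_all)
    finally show ?thesis .
  qed
  have "X * pochhammer (X + 1) n = (X + of_nat n) * pochhammer X n"
    by (simp only: pochhammer_rec[symmetric] pochhammer_rec')
  also have "\<dots> = X * pochhammer X n + of_nat n * pochhammer X n" by (simp add: algebra_simps)
  finally have "coeff (X * pochhammer (X + 1) n) (Suc m)
      = coeff (X * pochhammer X n + of_nat n * pochhammer X n) (Suc m)" by simp
  then have "coeff (pochhammer (X + 1) n) m = of_nat (stirling n m) + of_nat n * of_nat (stirling n (Suc m))"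
    unfolding coeff_add coeff_of_nat_mult coeff_P by (simp add: X_def coeff_P[unfolded X_def])
  moreover have "coeff (pochhammer (X + 1) n) m = (\<Sum>k\<le>n. of_nat (stirling n k) * of_nat (k choose m))"
  proof -
    have "X + 1 = [:1, 1:]" by (simp add: X_def one_pCons)
    then show ?thesis
      unfolding stirling_pochhammer[symmetric] coeff_sum coeff_of_nat_mult
      by (simp add: coeff_linear_power_binomial)
  qed
  ultimately have "int (\<Sum>k\<le>n. (k choose m) * stirling n k) = int (stirling n m + n * stirling n (Suc m))"
    by (simp add: mult.commute)
  then show ?thesis by (simp only: of_nat_eq_iff)
qed

text \<open>Lagrange's recurrence: \<open>stirling n (n - j)\<close> is the elementary symmetric
  function of degree j of 1, ..., n - 1. In the preceding identity at m = n - j - 1, the summand k =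
  m cancels, and the summand k = m + 1 reduces the factor n to j.\<close>

lemma stirling_recurrence_top:
  assumes "j < n"
  shows "j * stirling n (n - j) = (\<Sum>i<j. (n - i choose (Suc j - i)) * stirling n (n - i))"
proof -
  define m where "m = n - Suc j"
  have m: "Suc m = n - j" "Suc m \<le> n" using assms by (auto simp: m_def)
  have "(\<Sum>k\<le>n. (k choose m) * stirling n k) = (\<Sum>k\<in>{m..n}. (k choose m) * stirling n k)"
    by (rule sum.mono_neutral_right) auto
  also have "\<dots> = stirling n m + (\<Sum>k\<in>{Suc m..n}. (k choose m) * stirling n k)"
    using m by (subst sum.atLeast_Suc_atMost) auto
  also have "(\<Sum>k\<in>{Suc m..n}. (k choose m) * stirling n k)
      = Suc m * stirling n (Suc m) + (\<Sum>k\<in>{Suc (Suc m)..n}. (k choose m) * stirling n k)"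
    using m(2) by (subst sum.atLeast_Suc_atMost) auto
  finally have "n * stirling n (Suc m)
      = Suc m * stirling n (Suc m) + (\<Sum>k\<in>{Suc (Suc m)..n}. (k choose m) * stirling n k)"
    unfolding sum_binomial_stirling by simp
  moreover have "n = Suc m + j" using m assms by simp
  ultimately have "j * stirling n (Suc m) = (\<Sum>k\<in>{Suc (Suc m)..n}. (k choose m) * stirling n k)"
    by (metis add_mult_distrib add_left_cancel)
  \<comment> \<open>Put \<open>i = n - k\<close>. Then \<open>k - m = Suc j - i\<close>, and the
    symmetry of the binomial coefficient gives the stated lower index.\<close>
  also have "\<dots> = (\<Sum>i<j. (n - i choose (Suc j - i)) * stirling n (n - i))"
  proof (rule sum.reindex_bij_witness[of _ "\<lambda>i. n - i" "\<lambda>k. n - k"])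
    fix k assume "k \<in> {Suc (Suc m)..n}"
    then have k: "m + 2 \<le> k" "k \<le> n" by auto
    then show "n - (n - k) = k" "n - k \<in> {..<j}" using m assms by auto
    have "k choose m = k choose (k - m)" using k by (intro binomial_symmetric) auto
    moreover have "k - m = Suc j - (n - k)" using k m assms by simp
    ultimately show "(n - (n - k) choose (Suc j - (n - k))) * stirling n (n - (n - k)) = (k choose m) * stirling n k"
      using k by simp
  next
    fix i assume "i \<in> {..<j}"
    then show "n - (n - i) = i" "n - i \<in> {Suc (Suc m)..n}" using m assms by auto
  qed
  finally show ?thesis using m by simp
qed

text \<open>The expansion of x (x + 1) ... (x + n) with the factor x removed. Induction avoids
  dividing by x, so the identity holds in any commutative ring and can be evaluated at
  polynomials.\<close>

lemma pochhammer_plus_one_conv_stirling: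
  "pochhammer (x + 1) n = (\<Sum>j\<le>n. of_nat (stirling (Suc n) (Suc j)) * x ^ j)" for x :: "'a::comm_ring_1"
proof (induction n)
  case 0
  show ?case by simp
next
  case (Suc n)
  let ?s = "\<lambda>j. of_nat (stirling (Suc n) j) :: 'a"
  have "(\<Sum>j\<le>Suc n. of_nat (stirling (Suc (Suc n)) (Suc j)) * x ^ j)
      = of_nat (Suc n) * (\<Sum>j\<le>Suc n. ?s (Suc j) * x ^ j) + (\<Sum>j\<le>Suc n. ?s j * x ^ j)"
    unfolding stirling.simps(4)[of "Suc n"] of_nat_add of_nat_mult
    by (simp only: sum_distrib_left sum.distrib distrib_right mult.assoc)
  also have "(\<Sum>j\<le>Suc n. ?s (Suc j) * x ^ j) = pochhammer (x + 1) n"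
    unfolding Suc.IH by simp
  also have "(\<Sum>j\<le>Suc n. ?s j * x ^ j) = x * pochhammer (x + 1) n"
    unfolding Suc.IH sum.atMost_Suc_shift by (simp add: sum_distrib_left mult_ac del: stirling.simps(4))
  finally show ?case unfolding pochhammer_rec' by (simp add: algebra_simps)
qed

text \<open>For F(x) = (x + 1) ... (x + n) and q = n + 1, the substitution x -> - q - x reverses the
  factors and changes n signs, an even number. The claim compares the coefficients of X^i in F(q X)
  = F(- q - q X).\<close>

lemma stirling_symmetry:
  assumes "even n"
  shows "(of_nat (Suc n) :: rat) ^ i * of_nat (stirling (Suc n) (Suc i))
    = (\<Sum>j\<le>n. (-1) ^ j * of_nat (j choose i) * (of_nat (Suc n) ^ j * of_nat (stirling (Suc n) (Suc j))))"
proof -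
  define q where "q = (of_nat (Suc n) :: rat)"
  let ?s = "\<lambda>j. of_nat (stirling (Suc n) (Suc j)) :: rat"
  have coeff_poch: "coeff (pochhammer ([:a, b:] + 1) n) i
      = (\<Sum>j\<le>n. ?s j * (of_nat (j choose i) * b ^ i * a ^ (j - i)))" for a b
    unfolding pochhammer_plus_one_conv_stirling coeff_sum coeff_of_nat_mult coeff_linear_power_binomial ..
  have arg: "[:- q, - q:] + 1 = - ([:0, q:] + of_nat n)"
    by (simp add: q_def one_pCons of_nat_poly)
  have "pochhammer ([:- q, - q:] + 1) n = pochhammer ([:0, q:] + 1) n"
    unfolding arg pochhammer_minus using assms by simp
  then have "(\<Sum>j\<le>n. ?s j * (of_nat (j choose i) * q ^ i * 0 ^ (j - i)))
      = (\<Sum>j\<le>n. ?s j * (of_nat (j choose i) * (- q) ^ i * (- q) ^ (j - i)))"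
    unfolding coeff_poch[symmetric] by simp
  \<comment> \<open>Here \<open>0 ^ 0 = 1\<close> selects \<open>j = i\<close>. For
    \<open>j < i\<close> the truncated difference also gives \<open>0 ^ 0\<close>, but the binomial
    coefficient vanishes.\<close>
  also have "(\<Sum>j\<le>n. ?s j * (of_nat (j choose i) * q ^ i * 0 ^ (j - i)))
      = (\<Sum>j\<le>n. if j = i then ?s j * q ^ i else 0)"
    by (rule sum.cong) (auto simp: power_0_left not_le less_imp_le)
  also have "\<dots> = q ^ i * ?s i" by (simp del: stirling.simps)
  also have "(\<Sum>j\<le>n. ?s j * (of_nat (j choose i) * (- q) ^ i * (- q) ^ (j - i)))
      = (\<Sum>j\<le>n. (-1) ^ j * of_nat (j choose i) * (q ^ j * ?s j))"
  proof (rule sum.cong)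
    fix j
    show "?s j * (of_nat (j choose i) * (- q) ^ i * (- q) ^ (j - i)) = (-1) ^ j * of_nat (j choose i) * (q ^ j * ?s j)"
    proof (cases "i \<le> j")
      case True
      then have "(- q) ^ i * (- q) ^ (j - i) = (-1) ^ j * q ^ j"
        by (simp add: power_add[symmetric] power_minus[of q j])
      then show ?thesis by (simp add: mult_ac del: stirling.simps)
    qed (simp add: binomial_eq_0)
  qed simp
  finally show ?thesis unfolding q_def .
qed

text \<open>The reflection identity with n = p - 1, divided by (p - 1)!. It supplies one linear
  relation for each i, and these relations account for the freedom in the choice of c.\<close>

lemma elem_harmonic_symmetry:
  assumes "odd p"
  shows "of_nat p ^ i * elem_harmonic i (p - 1)
    = (\<Sum>j<p. (-1) ^ j * of_nat (j choose i) * (of_nat p ^ j * elem_harmonic j (p - 1)))"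
proof -
  obtain n where n: "p = Suc n" "even n" using assms by (cases p) auto
  show ?thesis
    unfolding n diff_Suc_1 elem_harmonic_conv_stirling lessThan_Suc_atMost times_divide_eq_right
      sum_divide_distrib[symmetric] stirling_symmetry[OF n(2), of i] ..
qed

text \<open>The binomial coefficient is the product of ((k - 1) p + i) / i over i = 1, ..., p - 1,
  that is, the generating polynomial of the harmonic sums at (k - 1) p.\<close>

lemma gbinomial_conv_elem_harmonic:
  assumes "p > 0"
  shows "(of_int (k * int p - 1) gchoose (p - 1))
    = (\<Sum>j<p. of_int (k - 1) ^ j * (of_nat p ^ j * elem_harmonic j (p - 1)))"
proof -
  obtain n where n: "p = Suc n" using assms by (cases p) auto
  have arg: "of_int (k * int (Suc n) - 1) - of_nat n + 1 = of_int (k - 1) * (of_nat (Suc n) :: rat) + 1"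
    by (simp add: algebra_simps)
  show ?thesis
    unfolding n diff_Suc_1 elem_harmonic_conv_stirling lessThan_Suc_atMost times_divide_eq_right
      sum_divide_distrib[symmetric] gbinomial_pochhammer' arg pochhammer_plus_one_conv_stirling
    by (simp add: power_mult_distrib mult_ac del: stirling.simps of_nat_Suc)
qed

text \<open>Weight the i-th reflection relation by \<open>c i\<close> and add: the contributions of
  c to b cancel in the full sum, which leaves the expansion in powers of k - 1.\<close>

lemma gbinomial_eq_sum_elem_harmonic:
  fixes c b :: "nat \<Rightarrow> rat"
  assumes b: "\<And>j. b j = of_int (k - 1) ^ j + c j
                     + (-1) ^ (j + 1) * (\<Sum>i=0..j. of_nat (j choose i) * c i)"
    and p: "odd p"
  shows "(of_int (k * int p - 1) gchoose (p - 1)) = (\<Sum>j<p. b j * of_nat p ^ j * elem_harmonic j (p - 1))"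
proof -
  define T where "T j = of_nat p ^ j * elem_harmonic j (p - 1)" for j
  have "(\<Sum>i<p. c i * T i) = (\<Sum>i<p. \<Sum>j<p. c i * ((-1) ^ j * of_nat (j choose i) * T j))"
    unfolding sum_distrib_left[symmetric] T_def elem_harmonic_symmetry[OF p, symmetric] ..
  also have "\<dots> = (\<Sum>j<p. \<Sum>i<p. c i * ((-1) ^ j * of_nat (j choose i) * T j))"
    by (rule sum.swap)
  also have "\<dots> = (\<Sum>j<p. (-1) ^ j * (\<Sum>i=0..j. of_nat (j choose i) * c i) * T j)"
  proof (rule sum.cong)
    fix j assume "j \<in> {..<p}"
    then have "(\<Sum>i=0..j. of_nat (j choose i) * c i) = (\<Sum>i<p. of_nat (j choose i) * c i)"
      by (intro sum.mono_neutral_left) auto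
    then show "(\<Sum>i<p. c i * ((-1) ^ j * of_nat (j choose i) * T j))
        = (-1) ^ j * (\<Sum>i=0..j. of_nat (j choose i) * c i) * T j"
      by (simp add: sum_distrib_left sum_distrib_right mult_ac)
  qed simp
  finally have "(\<Sum>j<p. c j * T j) = (\<Sum>j<p. (-1) ^ j * (\<Sum>i=0..j. of_nat (j choose i) * c i) * T j)" .
  moreover have "(\<Sum>j<p. b j * T j) = (\<Sum>j<p. of_int (k - 1) ^ j * T j) + (\<Sum>j<p. c j * T j)
      - (\<Sum>j<p. (-1) ^ j * (\<Sum>i=0..j. of_nat (j choose i) * c i) * T j)"
    unfolding b sum.distrib[symmetric] sum_subtractf[symmetric]
    by (rule sum.cong) (simp_all add: algebra_simps)
  moreover have "p > 0" using p by (rule odd_pos)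
  ultimately show ?thesis
    using gbinomial_conv_elem_harmonic[of p k] by (simp add: T_def mult.assoc)
qed

lemma elem_harmonic_eq_0: "j > m \<Longrightarrow> elem_harmonic j m = 0"
  by (simp add: elem_harmonic_conv_stirling del: stirling.simps)

subsection \<open>Congruences modulo powers of p\<close>

context p_adic
begin

section \<open>Stirling, binomial and Bernoulli numbers modulo p and p^2\<close>

lemma not_dvd_less: "0 < d \<Longrightarrow> d < p \<Longrightarrow> \<not> p dvd d"
  by (auto dest: dvd_imp_le)

lemma not_dvd_fact: "r < p \<Longrightarrow> \<not> p dvd fact r"
  using prime by (simp add: prime_dvd_fact_iff)

text \<open>Strong induction with Lagrange's recurrence: the summand i = 0 is
  \<open>p choose Suc j\<close>, a multiple of p since 0 < j + 1 < p; the others are multiples of p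
  by induction; and the factor j on the left is prime to p.\<close>

lemma stirling_dvd:
  assumes "0 < j" "j + 2 \<le> p"
  shows "p dvd stirling p (p - j)"
  using assms
proof (induction j rule: less_induct)
  case (less j)
  have "p dvd (\<Sum>i<j. (p - i choose (Suc j - i)) * stirling p (p - i))"
  proof (rule dvd_sum)
    fix i assume i: "i \<in> {..<j}"
    show "p dvd (p - i choose (Suc j - i)) * stirling p (p - i)"
    proof (cases "i = 0")
      case True
      have "p dvd p choose Suc j" using less.prems prime by (intro dvd_choose_prime) auto
      then show ?thesis using True by simp
    next
      case False
      then show ?thesis using less i by (intro dvd_mult less.IH) auto
    qed
  qed
  then have "p dvd j * stirling p (p - j)"
    using stirling_recurrence_top[of j p] less.prems by simp
  then show ?case using not_dvd_less[of j] less.prems prime by (simp add: prime_dvd_mult_iff)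
qed

text \<open>Modulo p the numerator does not distinguish p - a from - a, while r! is a unit; negating
  the upper index of the generalised binomial coefficient gives the stated form.\<close>

lemma binomial_cong:
  assumes "0 < a" "a \<le> p" "r < p"
  shows "pdvd 1 (of_nat (p - a choose r) - (-1) ^ r * of_nat (a + r - 1 choose r))"
proof -
  let ?P = "\<lambda>x. \<Prod>t = 0..<r. x - int t"
  have "(of_nat (p - a choose r) :: rat) = of_int (int p - int a) gchoose r"
    using assms by (simp add: binomial_gbinomial of_nat_diff)
  also have "\<dots> = of_int (?P (int p - int a)) / fact r"
    by (simp add: gbinomial_prod_rev)
  finally have 1: "(of_nat (p - a choose r) :: rat) = of_int (?P (int p - int a)) / fact r" .
  have "(-1) ^ r * (of_nat (a + r - 1 choose r) :: rat) = of_int (- int a) gchoose r"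
    using assms by (simp add: binomial_gbinomial gbinomial_minus of_nat_diff)
  also have "\<dots> = of_int (?P (- int a)) / fact r"
    by (simp add: gbinomial_prod_rev)
  finally have 2: "(-1) ^ r * (of_nat (a + r - 1 choose r) :: rat) = of_int (?P (- int a)) / fact r" .
  have "[?P (int p - int a) = ?P (- int a)] (mod int p)"
    by (intro cong_prod) (simp add: cong_iff_dvd_diff)
  then have "int p dvd ?P (int p - int a) - ?P (- int a)"
    by (simp add: cong_iff_dvd_diff)
  then have "pdvd 1 (of_int (?P (int p - int a) - ?P (- int a)) / of_nat (fact r))"
    by (intro pdvd_divide_nat pdvd_of_int not_dvd_fact assms)
  then show ?thesis unfolding 1 2 by (simp add: diff_divide_distrib)
qed

text \<open>Solving the recurrence for \<open>bernoulli j\<close> divides only by j + 1, which is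
  less than p.\<close>

lemma bernoulli_integral:
  assumes "j + 2 \<le> p"
  shows "p_integral p (bernoulli j)"
  using assms
proof (induction j rule: less_induct)
  case (less j)
  show ?case
  proof (cases "j = 0")
    case True
    then show ?thesis by (simp add: bernoulli_zero)
  next
    case False
    then have "(\<Sum>i\<le>j. of_nat (Suc j choose i) * bernoulli i) = 0" by (intro bernoulli_recurrence) simp
    moreover have "(\<Sum>i\<le>j. of_nat (Suc j choose i) * bernoulli i)
      = (\<Sum>i<j. of_nat (Suc j choose i) * bernoulli i) + of_nat (Suc j) * bernoulli j"
      unfolding lessThan_Suc_atMost[symmetric] sum.lessThan_Suc by simp
    ultimately have "bernoulli j = - (\<Sum>i<j. of_nat (Suc j choose i) * bernoulli i) / of_nat (Suc j)"
      by (simp add: field_simps)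
    moreover have "p_integral p (- (\<Sum>i<j. of_nat (Suc j choose i) * bernoulli i) / of_nat (Suc j))"
      using less by (intro p_integral_divide_nat not_dvd_less p_integral_minus p_integral_sum p_integral_mult less.IH) auto
    ultimately show ?thesis by simp
  qed
qed

text \<open>Modulo p^2, Lagrange's recurrence needs its binomial coefficients for 0 < i < j only
  modulo p, because there the Stirling numbers are multiples of p. After
  \<open>binomial_cong\<close> it becomes the Bernoulli recurrence, and strong induction
  applies.\<close>

lemma stirling_cong_bernoulli:
  assumes "0 < j" "j + 2 \<le> p"
  shows "pdvd 2 (of_nat (stirling p (p - j)) - of_nat p * ((-1) ^ (j + 1) * bernoulli j / of_nat j))"
  using assms
proof (induction j rule: less_induct)
  case (less j)
  define A :: "nat \<Rightarrow> rat" where "A i = of_nat (stirling p (p - i))" for i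
  define \<beta> where "\<beta> i = (-1) ^ (i + 1) * bernoulli i / of_nat i" for i
  define q where "q = (of_nat p :: rat)"
  define u where "u i = (of_nat (p - i choose (Suc j - i)) :: rat)" for i
  define v where "v i = (-1) ^ (Suc j - i) * (of_nat (j choose (Suc j - i)) :: rat)" for i
  have q1: "pdvd 1 q" using pdvd_power[of 1] by (simp add: q_def)
  have uv: "pdvd 1 (u i - v i)" if "i \<in> {1..<j}" for i
    using binomial_cong[of i "Suc j - i"] that less.prems by (simp add: u_def v_def)
  have \<beta>: "p_integral p (\<beta> i)" if "i \<in> {1..<j}" for i
    unfolding \<beta>_def using that less.prems
    by (intro p_integral_divide_nat p_integral_mult bernoulli_integral not_dvd_less p_integral_power p_integral_minus) auto
  have IH: "pdvd 2 (A i - q * \<beta> i)" if "i \<in> {1..<j}" for i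
    using less.IH[of i] that less.prems by (simp add: A_def \<beta>_def q_def)
  \<comment> \<open>Uses u A - q v \<beta> = u (A - q \<beta>) + \<beta> q (u - v); the second
    summand gets one factor p from q and one from u - v.\<close>
  have term_cong: "pdvd 2 (u i * A i - q * (v i * \<beta> i))" if "i \<in> {1..<j}" for i
  proof -
    have "p_integral p (u i)" by (simp add: u_def)
    then have "pdvd 2 (u i * (A i - q * \<beta> i))"
      using IH[OF that] by (rule pdvd_mult_left)
    moreover have "pdvd 2 (\<beta> i * (q * (u i - v i)))"
      using pdvd_mult_left[OF \<beta>[OF that] pdvd_mult[OF q1 uv[OF that]]] by (simp add: numeral_2_eq_2)
    ultimately have "pdvd 2 (u i * (A i - q * \<beta> i) + \<beta> i * (q * (u i - v i)))"
      by (rule pdvd_add)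
    then show ?thesis by (simp add: algebra_simps)
  qed
  \<comment> \<open>The summand i = 0, by absorption and \<open>p - 1 choose j\<close> \<equiv>
    (-1)^j modulo p.\<close>
  have top: "pdvd 2 (of_nat (p choose Suc j) - q * ((-1) ^ j / of_nat (Suc j)))"
  proof -
    have "Suc j * (p choose Suc j) = p * (p - 1 choose j)"
      by (rule binomial_absorption)
    then have "of_nat (Suc j) * (of_nat (p choose Suc j) :: rat) = q * of_nat (p - 1 choose j)"
      unfolding q_def by (metis of_nat_mult)
    then have "of_nat (p choose Suc j) = q * of_nat (p - 1 choose j) / of_nat (Suc j)"
      by (simp add: nonzero_eq_divide_eq mult.commute del: of_nat_Suc)
    then have "of_nat (p choose Suc j) - q * ((-1) ^ j / of_nat (Suc j))
      = q * (of_nat (p - 1 choose j) - (-1) ^ j) / of_nat (Suc j)"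
      by (simp add: right_diff_distrib diff_divide_distrib)
    moreover have "pdvd 1 (of_nat (p - 1 choose j) - (-1) ^ j)"
      using binomial_cong[of 1 j] less.prems by simp
    then have "pdvd 2 (q * (of_nat (p - 1 choose j) - (-1) ^ j) / of_nat (Suc j))"
      using pdvd_mult[OF q1, of 1] less.prems
      by (intro pdvd_divide_nat not_dvd_less) (simp_all add: numeral_2_eq_2)
    ultimately show ?thesis by simp
  qed
  have split0: "{..<j} = insert 0 {1..<j}" using less.prems by auto
  have "of_nat j * A j = (\<Sum>i<j. u i * A i)"
    using arg_cong[OF stirling_recurrence_top[of j p], of "of_nat :: nat \<Rightarrow> rat"] less.prems
    by (simp add: A_def u_def)
  also have "\<dots> = of_nat (p choose Suc j) + (\<Sum>i\<in>{1..<j}. u i * A i)"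
    unfolding split0 by (subst sum.insert) (simp_all add: u_def A_def)
  finally have A_rec: "of_nat j * A j = of_nat (p choose Suc j) + (\<Sum>i\<in>{1..<j}. u i * A i)" .
  \<comment> \<open>Absorption turns the binomial coefficients of j into those of j + 1, and the
    signs combine to one independent of i. What remains is the Bernoulli recurrence with the
    summands 0 and j isolated.\<close>
  have \<beta>_rec: "of_nat j * \<beta> j = (-1) ^ j / of_nat (Suc j) + (\<Sum>i\<in>{1..<j}. v i * \<beta> i)"
  proof -
    have v\<beta>: "v i * \<beta> i = (-1) ^ j * (of_nat (Suc j choose i) * bernoulli i) / of_nat (Suc j)"
      if i: "i \<in> {1..<j}" for i
    proof -
      obtain h where h: "i = Suc h" using i by (cases i) auto
      have "j choose (Suc j - i) = j choose h" using i h by (subst binomial_symmetric) auto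
      moreover have "i * (Suc j choose i) = Suc j * (j choose h)"
        unfolding h by (metis Suc_times_binomial_eq mult.commute)
      then have "of_nat i * (of_nat (Suc j choose i) :: rat) = of_nat (Suc j) * of_nat (j choose h)"
        by (metis of_nat_mult)
      then have "(of_nat (j choose h) :: rat) / of_nat i = of_nat (Suc j choose i) / of_nat (Suc j)"
        using i by (simp add: frac_eq_eq mult.commute del: of_nat_Suc)
      moreover have "(-1) ^ (Suc j - i) * (-1) ^ (i + 1) = ((-1) ^ j :: rat)"
        using i by (simp add: power_add[symmetric])
      moreover have "v i * \<beta> i
        = ((-1) ^ (Suc j - i) * (-1) ^ (i + 1)) * (of_nat (j choose (Suc j - i)) / of_nat i) * bernoulli i"
        by (simp add: v_def \<beta>_def)
      ultimately show ?thesis by simp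
    qed
    have "(\<Sum>i\<le>j. of_nat (Suc j choose i) * bernoulli i) = 0"
      using less.prems by (intro bernoulli_recurrence) simp
    moreover have "{..j} = insert 0 (insert j {1..<j})" using less.prems by auto
    ultimately have "1 + (of_nat (Suc j) * bernoulli j + (\<Sum>i\<in>{1..<j}. of_nat (Suc j choose i) * bernoulli i)) = 0"
      using less.prems by (simp add: bernoulli_zero)
    then have "(\<Sum>i\<in>{1..<j}. of_nat (Suc j choose i) * bernoulli i) = - 1 - of_nat (Suc j) * bernoulli j"
      by simp
    moreover have "(\<Sum>i\<in>{1..<j}. v i * \<beta> i)
      = (-1) ^ j * (\<Sum>i\<in>{1..<j}. of_nat (Suc j choose i) * bernoulli i) / of_nat (Suc j)"
      unfolding sum_distrib_left sum_divide_distrib by (rule sum.cong) (simp_all only: v\<beta>)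
    moreover have "of_nat j * \<beta> j = - ((-1) ^ j * bernoulli j)"
      using less.prems by (simp add: \<beta>_def)
    moreover have "- (e * x) = e / n + e * (- 1 - n * x) / n" if "n \<noteq> 0" for e x n :: rat
      using that by (simp add: field_simps)
    ultimately show ?thesis
      by (simp only: of_nat_neq_0 not_False_eq_True)
  qed
  have "pdvd 2 ((of_nat (p choose Suc j) - q * ((-1) ^ j / of_nat (Suc j)))
      + (\<Sum>i\<in>{1..<j}. u i * A i - q * (v i * \<beta> i)))"
    by (intro pdvd_add top pdvd_sum term_cong)
  also have "(of_nat (p choose Suc j) - q * ((-1) ^ j / of_nat (Suc j)))
      + (\<Sum>i\<in>{1..<j}. u i * A i - q * (v i * \<beta> i)) = of_nat j * A j - q * (of_nat j * \<beta> j)"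
    unfolding A_rec \<beta>_rec sum_subtractf sum_distrib_left[symmetric] by (simp add: algebra_simps)
  finally have "pdvd 2 ((of_nat j * A j - q * (of_nat j * \<beta> j)) / of_nat j)"
    using less.prems by (intro pdvd_divide_nat not_dvd_less) auto
  also have "(of_nat j * A j - q * (of_nat j * \<beta> j)) / of_nat j = A j - q * \<beta> j"
    using less.prems by (simp add: field_simps)
  finally show ?case unfolding A_def \<beta>_def q_def .
qed

section \<open>Harmonic sums modulo powers of p\<close>

lemma fact_cong: "pdvd 1 (fact (p - 1) + 1)"
proof -
  have "[fact (p - 1) = - 1] (mod int p)" using prime by (rule wilson_theorem)
  then have "int p dvd fact (p - 1) + 1" by (simp add: cong_iff_dvd_diff)
  then show ?thesis by (metis pdvd_of_int of_int_add of_int_fact of_int_1)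
qed

lemma elem_harmonic_pred: "elem_harmonic j (p - 1) = of_nat (stirling p (Suc j)) / of_nat (fact (p - 1))"
  using p_pos by (simp add: elem_harmonic_conv_stirling del: stirling.simps)

lemma not_dvd_fact_pred: "\<not> p dvd fact (p - 1)"
  using not_dvd_fact p_pos by simp

lemma elem_harmonic_integral: "p_integral p (elem_harmonic j (p - 1))"
  unfolding elem_harmonic_pred by (intro p_integral_divide_nat not_dvd_fact_pred p_integral_of_nat)

lemma elem_harmonic_dvd:
  assumes "0 < j" "j + 2 \<le> p"
  shows "pdvd 1 (elem_harmonic j (p - 1))"
proof -
  have "p - (p - Suc j) = Suc j" using assms by simp
  then have "p dvd stirling p (Suc j)" using stirling_dvd[of "p - Suc j"] assms by simp
  then show ?thesis
    unfolding elem_harmonic_pred by (intro pdvd_divide_nat pdvd_of_nat not_dvd_fact_pred)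
qed

text \<open>Only one tuple uses all of 1, ..., p - 1, so the sum is 1 / (p - 1)!, to which Wilson's
  theorem applies.\<close>

lemma elem_harmonic_top: "pdvd 1 (elem_harmonic (p - 1) (p - 1) + 1)"
proof -
  have "elem_harmonic (p - 1) (p - 1) = 1 / of_nat (fact (p - 1))"
    unfolding elem_harmonic_pred using p_pos by simp
  then have "elem_harmonic (p - 1) (p - 1) + 1 = (fact (p - 1) + 1) / of_nat (fact (p - 1))"
    by (simp add: field_simps)
  then show ?thesis
    using pdvd_divide_nat[OF fact_cong not_dvd_fact_pred] by simp
qed

text \<open>Put i = p - 1 - j, which is even and positive. Dividing
  \<open>stirling p (Suc j)\<close> \<equiv> - p B_i / i by (p - 1)! leaves the denominator i (p -
  1)!, which is j + 1 modulo p by Wilson's theorem and i \<equiv> - (j + 1). The factor p in front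
  raises the precision to p^2.\<close>

lemma elem_harmonic_even:
  assumes "odd p" "even j" "0 < j" "j + 2 \<le> p"
  shows "pdvd 2 (elem_harmonic j (p - 1) + of_nat p * bernoulli (p - 1 - j) / of_nat (j + 1))"
proof -
  define i where "i = p - 1 - j"
  define f where "f = (of_nat (fact (p - 1)) :: rat)"
  define A where "A = (of_nat (stirling p (Suc j)) :: rat)"
  have i: "0 < i" "i + 2 \<le> p" "even i" "p - i = Suc j" and ij: "i + (j + 1) = p"
    using assms by (auto simp: i_def)
  have f0: "f \<noteq> 0" by (simp add: f_def)
  have i0: "of_nat i \<noteq> (0::rat)" using i by simp
  have A: "pdvd 2 (A + of_nat p * (bernoulli i / of_nat i))"
    using stirling_cong_bernoulli[OF i(1,2)] i by (simp add: A_def del: stirling.simps)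
  have ij': "of_nat i = of_nat p - (of_nat (j + 1) :: rat)"
    using ij by (metis add_diff_cancel_right' of_nat_add)
  have num: "pdvd 1 (of_nat i * f - of_nat (j + 1))"
  proof -
    have "of_nat i * f - of_nat (j + 1) = of_nat p * f - of_nat (j + 1) * (f + 1)"
      unfolding ij' by (simp add: algebra_simps)
    moreover have "pdvd 1 (of_nat p * f)" by (rule pdvdI[of f]) (simp_all add: f_def del: of_nat_fact)
    moreover have "pdvd 1 (of_nat (j + 1) * (f + 1))"
      by (intro pdvd_mult_left p_integral_of_nat) (use fact_cong in \<open>simp add: f_def\<close>)
    ultimately show ?thesis by (simp only: pdvd_diff)
  qed
  \<comment> \<open>The error made on replacing the denominator i (p - 1)! by j + 1.\<close>
  have "pdvd 2 (of_nat p * bernoulli i * (of_nat i * f - of_nat (j + 1)) / of_nat (j + 1) / of_nat i / f)"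
  proof -
    have "pdvd 1 (of_nat p * bernoulli i)"
      using i by (intro pdvdI[of "bernoulli i"] bernoulli_integral) auto
    from pdvd_mult[OF this num]
    have "pdvd 2 (of_nat p * bernoulli i * (of_nat i * f - of_nat (j + 1)))" by (simp add: numeral_2_eq_2)
    then show ?thesis
      unfolding f_def using i assms by (intro pdvd_divide_nat not_dvd_fact_pred not_dvd_less) auto
  qed
  moreover have "pdvd 2 ((A + of_nat p * (bernoulli i / of_nat i)) / f)"
    unfolding f_def by (intro pdvd_divide_nat A not_dvd_fact_pred)
  ultimately have "pdvd 2 (of_nat p * bernoulli i * (of_nat i * f - of_nat (j + 1)) / of_nat (j + 1) / of_nat i / f
      + (A + of_nat p * (bernoulli i / of_nat i)) / f)"
    by (rule pdvd_add)
  also have "of_nat p * bernoulli i * (of_nat i * f - of_nat (j + 1)) / of_nat (j + 1) / of_nat i / f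
      + (A + of_nat p * (bernoulli i / of_nat i)) / f = A / f + of_nat p * bernoulli i / of_nat (j + 1)"
    using f0 i0 by (simp add: divide_simps del: of_nat_add of_nat_Suc) (simp add: algebra_simps)
  finally show ?thesis unfolding elem_harmonic_pred A_def f_def i_def .
qed

text \<open>In the j-th reflection relation the summands below j vanish, and the j-th one, negative
  because j is odd, doubles the left side. The next summand is the main term; all later ones are
  divisible by p^(j+3). Cancelling 2 p^j gives the claim.\<close>

lemma elem_harmonic_odd:
  assumes "odd p" "odd j" "j + 3 \<le> p"
  shows "pdvd 3 (elem_harmonic j (p - 1) - of_nat p * of_nat (j + 1) / 2 * elem_harmonic (j + 1) (p - 1))"
proof -
  define H where "H i = elem_harmonic i (p - 1)" for i
  define q where "q = (of_nat p :: rat)"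
  define r where "r i = (-1) ^ i * of_nat (i choose j) * (q ^ i * H i)" for i
  have q0: "q \<noteq> 0" using p_pos by (simp add: q_def)
  have "{..<p} = insert j (insert (j + 1) ({..<j} \<union> {j + 2..<p}))" using assms by auto
  moreover have "sum r ({..<j} \<union> {j + 2..<p}) = sum r {..<j} + sum r {j + 2..<p}"
    by (rule sum.union_disjoint) auto
  ultimately have "(\<Sum>i<p. r i) = (\<Sum>i<j. r i) + (r j + r (j + 1) + (\<Sum>i\<in>{j + 2..<p}. r i))"
    by simp
  also have "(\<Sum>i<j. r i) = 0" by (rule sum.neutral) (simp add: r_def binomial_eq_0)
  also have "r j = - (q ^ j * H j)" using assms by (simp add: r_def)
  also have "r (j + 1) = of_nat (j + 1) * (q ^ (j + 1) * H (j + 1))" using assms by (simp add: r_def)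
  finally have sym: "2 * (q ^ j * H j) = of_nat (j + 1) * (q ^ (j + 1) * H (j + 1)) + (\<Sum>i\<in>{j + 2..<p}. r i)"
    using elem_harmonic_symmetry[OF assms(1), of j] by (simp add: r_def q_def H_def)
  have "pdvd (j + 3) (r i)" if "i \<in> {j + 2..<p}" for i
  proof -
    \<comment> \<open>For i = j + 2 one more factor p is needed: i is odd, so it differs from p - 1,
      and the harmonic sum itself is divisible by p. For larger i the power of p suffices.\<close>
    have "pdvd (j + 3) (q ^ i * H i)"
    proof (cases "i = j + 2")
      case True
      then have "odd i" using assms by simp
      then have "i \<noteq> p - 1" using assms that by auto
      then have "pdvd 1 (H i)" unfolding H_def using that True by (intro elem_harmonic_dvd) auto
      then show ?thesis
        using pdvd_mult[OF pdvd_power[of i], of 1 "H i"] True by (simp add: q_def numeral_3_eq_3)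
    next
      case False
      have "pdvd i (q ^ i * H i)"
        unfolding q_def H_def by (rule pdvdI[OF elem_harmonic_integral refl])
      then show ?thesis by (rule pdvd_mono) (use False that in auto)
    qed
    moreover have "p_integral p ((-1) ^ i * of_nat (i choose j))"
      by (intro p_integral_mult p_integral_power p_integral_minus) simp_all
    ultimately show ?thesis unfolding r_def by (rule pdvd_mult_left[rotated])
  qed
  then have "pdvd (j + 3) (\<Sum>i\<in>{j + 2..<p}. r i)" by (rule pdvd_sum)
  then obtain z where z: "p_integral p z" "(\<Sum>i\<in>{j + 2..<p}. r i) = q ^ (j + 3) * z"
    unfolding pdvd_def q_def by blast
  have "q ^ j * (2 * H j) = q ^ j * (of_nat (j + 1) * q * H (j + 1) + q ^ 3 * z)"
    using sym unfolding z by (simp add: algebra_simps power_add)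
  then have "2 * H j = of_nat (j + 1) * q * H (j + 1) + q ^ 3 * z"
    using q0 by simp
  then have "H j - q * of_nat (j + 1) / 2 * H (j + 1) = q ^ 3 * (z / of_nat 2)"
    by (simp add: field_simps)
  moreover have "\<not> p dvd 2" using assms by (intro not_dvd_less) auto
  ultimately show ?thesis
    unfolding H_def q_def using z(1) by (intro pdvdI[of "z / of_nat 2"] p_integral_divide_nat)
qed

end

subsection \<open>The expansion of the binomial coefficient\<close>

theorem theorem3p3:
  fixes k :: int and c b :: "nat \<Rightarrow> rat" and p N :: nat and E S :: rat
  assumes b: "\<And>j. b j = of_int (k - 1) ^ j + c j
                     + (-1) ^ (j + 1) * (\<Sum>i=0..j. of_nat (j choose i) * c i)"
    and p: "prime p" "odd p"
    and c: "\<And>i. p_integral p (c i)"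
    and S: "S = (\<Sum>j=0..N. b j * of_nat p ^ j * elem_harmonic j (p - 1))"
    and E: "E = (of_int (k * int p - 1) gchoose (p - 1)) - S"
  shows
    "(N + 4 \<le> p \<and> even N \<longrightarrow>
        rat_cong p (N + 4) E
          (- bernoulli (p - 3 - N) / of_nat (N + 3)
             * (of_nat (N + 2) / 2 * b (N + 1) + b (N + 2)) * of_nat p ^ (N + 3)))
   \<and> (N + 4 \<le> p \<and> odd N \<longrightarrow>
        rat_cong p (N + 3) E
          (- bernoulli (p - 2 - N) / of_nat (N + 2) * b (N + 1) * of_nat p ^ (N + 2)))
   \<and> (N + 3 = p \<longrightarrow>
        rat_cong p (N + 3) E ((b (N + 1) / 2 - b (N + 2)) * of_nat p ^ (N + 2)))
   \<and> (N + 2 = p \<longrightarrow>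
        rat_cong p (N + 2) E (- b (N + 1) * of_nat p ^ (N + 1)))
   \<and> (p \<le> N + 1 \<longrightarrow> E = 0)
   \<and> (N + 4 \<le> p \<and> even N \<longrightarrow>
        rat_cong p (N + 3) (of_int (k * int p - 1) gchoose (p - 1)) S)
   \<and> (N + 4 \<le> p \<and> odd N \<longrightarrow>
        rat_cong p (N + 2) (of_int (k * int p - 1) gchoose (p - 1)) S)
   \<and> (N + 3 = p \<longrightarrow>
        rat_cong p (N + 2) (of_int (k * int p - 1) gchoose (p - 1)) S)
   \<and> (N + 2 = p \<longrightarrow>
        rat_cong p (N + 1) (of_int (k * int p - 1) gchoose (p - 1)) S)
   \<and> (p \<le> N + 1 \<longrightarrow> (of_int (k * int p - 1) gchoose (p - 1)) = S)"
proof -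
  interpret p_adic p by unfold_locales (rule p(1))
  define H where "H j = elem_harmonic j (p - 1)" for j
  define q where "q = (of_nat p :: rat)"
  define t where "t j = b j * q ^ j * H j" for j
  have bi: "p_integral p (b j)" for j
    unfolding b by (intro p_integral_add p_integral_mult p_integral_sum p_integral_power p_integral_minus c)
      (simp_all add: p_integral_diff)
  have Hi: "p_integral p (H j)" for j
    unfolding H_def by (rule elem_harmonic_integral)
  have Si: "p_integral p S"
    unfolding S by (intro p_integral_mult p_integral_sum p_integral_power bi elem_harmonic_integral) simp
  have binom: "(of_int (k * int p - 1) gchoose (p - 1)) = (\<Sum>j<p. t j)"
    unfolding t_def H_def q_def by (rule gbinomial_eq_sum_elem_harmonic[OF b p(2)])
  have S': "S = (\<Sum>j\<le>N. t j)"
    unfolding S t_def H_def q_def atMost_atLeast0 ..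
  have E_tail: "E = (\<Sum>j\<in>{N + 1..<p}. t j)" if "N < p"
  proof -
    have "{..<p} = {..N} \<union> {N + 1..<p}" using that by auto
    moreover have "sum t ({..N} \<union> {N + 1..<p}) = sum t {..N} + sum t {N + 1..<p}"
      by (rule sum.union_disjoint) auto
    ultimately have "(\<Sum>j<p. t j) = (\<Sum>j\<le>N. t j) + (\<Sum>j\<in>{N + 1..<p}. t j)"
      by simp
    then show ?thesis unfolding E binom S' by simp
  qed
  have exact: "E = 0" if "p \<le> N + 1"
  proof -
    have "(\<Sum>j\<le>N. t j) = (\<Sum>j<p. t j)"
      by (rule sum.mono_neutral_right) (use that p_pos in \<open>auto simp: t_def H_def intro!: elem_harmonic_eq_0\<close>)
    then show ?thesis unfolding E binom S' by simp
  qed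
  have t_dvd: "pdvd m (t j)" if "m \<le> j" for m j
    by (rule pdvd_mono[OF _ that]) (use bi Hi in \<open>auto simp: t_def q_def mult_ac intro!: pdvdI[of "b j * H j" _ j]\<close>)
  \<comment> \<open>For 0 < j < p - 1 the harmonic sum contributes one factor p beyond p^j.\<close>
  have t_dvd': "pdvd m (t j)" if "m \<le> j + 1" "0 < j" "j + 2 \<le> p" for m j
  proof -
    have "pdvd 1 (H j)" unfolding H_def using that by (intro elem_harmonic_dvd)
    from pdvd_mult_left[OF bi pdvd_mult[OF pdvd_power this]]
    have "pdvd (j + 1) (t j)" unfolding t_def q_def mult.assoc .
    then show ?thesis by (rule pdvd_mono) (rule that)
  qed
  \<comment> \<open>Knowing \<open>H j\<close> modulo p^m determines the j-th term modulo
    p^(j+m).\<close>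
  have t_lift: "pdvd n (t j - b j * q ^ j * x)" if "pdvd m (H j - x)" "n = j + m" for j m n x
    unfolding that(2) using pdvd_mult_left[OF bi pdvd_mult[OF pdvd_power that(1)]]
    by (simp add: t_def q_def algebra_simps)
  \<comment> \<open>A leading term x p^m with integral x vanishes modulo p^m, which gives the weaker
    congruences between the binomial coefficient and S.\<close>
  have weaken: "rat_cong p m (of_int (k * int p - 1) gchoose (p - 1)) S"
    if "pdvd n (E - x * q ^ m)" "p_integral p x" "m \<le> n" for m n x
  proof (rule rat_congI[OF Si])
    have "pdvd m (x * q ^ m)" using that(2) by (intro pdvdI[of x]) (simp_all add: q_def)
    from pdvd_add[OF pdvd_mono[OF that(1,3)] this] have "pdvd m E" by simp
    then show "pdvd m ((of_int (k * int p - 1) gchoose (p - 1)) - S)" unfolding E .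
  qed
  have strong: "rat_cong p n E (x * q ^ m)" if "pdvd n (E - x * q ^ m)" "p_integral p x" for m n x
    using that by (intro rat_congI p_integral_mult p_integral_power) (simp_all add: q_def)

  \<comment> \<open>Coefficients of the leading terms: N even and N odd below p - 3, then N = p - 3
    and N = p - 2.\<close>
  define x1 where "x1 = - bernoulli (p - 3 - N) / of_nat (N + 3) * (of_nat (N + 2) / 2 * b (N + 1) + b (N + 2))"
  define x2 where "x2 = - bernoulli (p - 2 - N) / of_nat (N + 2) * b (N + 1)"
  define x3 where "x3 = b (N + 1) / 2 - b (N + 2)"
  define x4 where "x4 = - b (N + 1)"

  have half: "p_integral p (x / 2)" if "p_integral p x" "3 \<le> p" for x
    using p_integral_divide_nat[of x 2] that not_dvd_less[of 2] by simp

  \<comment> \<open>The terms N + 1 and N + 2 both contribute at order p^(N+3). The even one comes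
    from the Bernoulli congruence, and the odd one is reduced to it.\<close>
  have 1: "pdvd (N + 4) (E - x1 * q ^ (N + 3)) \<and> p_integral p x1" if "N + 4 \<le> p" "even N"
  proof
    define B where "B = bernoulli (p - 3 - N) / of_nat (N + 3)"
    \<comment> \<open>N + 4 is even and p is odd. The gap keeps N + 3 below p - 1, so its term has
      the extra factor p required for \<open>d3\<close>.\<close>
    have N5: "N + 5 \<le> p" using that p(2) by (cases "N + 4 = p") auto
    have Bi: "p_integral p B"
      unfolding B_def using that by (intro p_integral_divide_nat bernoulli_integral not_dvd_less) auto
    have x1: "x1 = - B * (of_nat (N + 2) / 2 * b (N + 1) + b (N + 2))"
      by (simp add: x1_def B_def)
    show "p_integral p x1"
      unfolding x1 using that
      by (intro p_integral_mult p_integral_minus p_integral_add half Bi bi p_integral_of_nat) auto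
    have e2: "pdvd 2 (H (N + 2) - (- q * B))"
    proof -
      have "p - 1 - (N + 2) = p - 3 - N" "N + 2 + 1 = N + 3" by simp_all
      then have "pdvd 2 (H (N + 2) + q * bernoulli (p - 3 - N) / of_nat (N + 3))"
        using elem_harmonic_even[of "N + 2"] N5 that p(2) by (simp only: H_def q_def) simp
      then show ?thesis by (simp add: B_def)
    qed
    have e1: "pdvd 3 (H (N + 1) - q * of_nat (N + 2) / 2 * H (N + 2))"
      using elem_harmonic_odd[of "N + 1"] N5 that p(2) by (simp add: H_def q_def)
    \<comment> \<open>The value of \<open>H (N + 1)\<close> obtained by putting the approximation -
      q B of \<open>H (N + 2)\<close> into \<open>e1\<close>; the factor q lifts the precision of
      \<open>e2\<close> from p^2 to p^3.\<close>
    define y where "y = q * of_nat (N + 2) / 2 * (- q * B)"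
    have "pdvd 3 (q * (of_nat (N + 2) / 2 * (H (N + 2) - (- q * B))))"
    proof -
      have "pdvd 1 q" using pdvd_power[of 1] by (simp add: q_def)
      moreover have "pdvd 2 (of_nat (N + 2) / 2 * (H (N + 2) - (- q * B)))"
        using that by (intro pdvd_mult_left e2 half p_integral_of_nat) auto
      ultimately have "pdvd (1 + 2) (q * (of_nat (N + 2) / 2 * (H (N + 2) - (- q * B))))"
        by (rule pdvd_mult)
      then show ?thesis by (simp add: numeral_3_eq_3)
    qed
    moreover have "h - q * n / 2 * g + q * (n / 2 * (g - (- q * B))) = h - q * n / 2 * (- q * B)" for h g n
      by (simp add: algebra_simps add_divide_distrib)
    ultimately have "pdvd 3 (H (N + 1) - y)"
      unfolding y_def using pdvd_add[OF e1] by metis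
    then have d1: "pdvd (N + 4) (t (N + 1) - b (N + 1) * q ^ (N + 1) * y)" by (rule t_lift) simp
    have d2: "pdvd (N + 4) (t (N + 2) - b (N + 2) * q ^ (N + 2) * (- q * B))"
      using e2 by (rule t_lift) simp
    have d3: "pdvd (N + 4) (\<Sum>j\<in>{N + 3..<p}. t j)"
    proof (rule pdvd_sum)
      fix j assume "j \<in> {N + 3..<p}"
      then show "pdvd (N + 4) (t j)"
        using N5 by (cases "j = N + 3") (auto intro: t_dvd t_dvd')
    qed
    have "{N + 1..<p} = insert (N + 1) (insert (N + 2) {N + 3..<p})" using that by auto
    then have "E = t (N + 1) + (t (N + 2) + (\<Sum>j\<in>{N + 3..<p}. t j))"
      using E_tail that by simp
    moreover have "b (N + 1) * q ^ (N + 1) * y + b (N + 2) * q ^ (N + 2) * (- q * B) = x1 * q ^ (N + 3)"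
    proof -
      have "q ^ (N + 1) = q ^ N * q" "q ^ (N + 2) = q ^ N * q * q" "q ^ (N + 3) = q ^ N * q * q * q"
        by (simp_all add: power_add power2_eq_square power3_eq_cube)
      then show ?thesis unfolding x1 y_def by (simp only:) (simp add: field_simps)
    qed
    ultimately have "E - x1 * q ^ (N + 3) = (t (N + 1) - b (N + 1) * q ^ (N + 1) * y)
        + ((t (N + 2) - b (N + 2) * q ^ (N + 2) * (- q * B)) + (\<Sum>j\<in>{N + 3..<p}. t j))"
      by simp
    then show "pdvd (N + 4) (E - x1 * q ^ (N + 3))"
      using pdvd_add[OF d1 pdvd_add[OF d2 d3]] by simp
  qed

  \<comment> \<open>Here N + 1 is even, so the Bernoulli congruence applies directly to the first
    term; the term N + 2 \<le> p - 2 has an extra factor p and joins the remainder.\<close>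
  have 2: "pdvd (N + 3) (E - x2 * q ^ (N + 2)) \<and> p_integral p x2" if "N + 4 \<le> p" "odd N"
  proof
    define B where "B = bernoulli (p - 2 - N) / of_nat (N + 2)"
    have Bi: "p_integral p B"
      unfolding B_def using that by (intro p_integral_divide_nat bernoulli_integral not_dvd_less odd_pos) (auto dest: odd_pos)
    have x2: "x2 = - B * b (N + 1)"
      by (simp add: x2_def B_def)
    show "p_integral p x2"
      unfolding x2 by (intro p_integral_mult p_integral_minus Bi bi)
    have "p - 1 - (N + 1) = p - 2 - N" "N + 1 + 1 = N + 2" by simp_all
    then have "pdvd 2 (H (N + 1) + q * bernoulli (p - 2 - N) / of_nat (N + 2))"
      using elem_harmonic_even[of "N + 1"] that p(2) by (simp only: H_def q_def) simp
    then have "pdvd 2 (H (N + 1) - (- q * B))"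
      by (simp add: B_def)
    then have d1: "pdvd (N + 3) (t (N + 1) - b (N + 1) * q ^ (N + 1) * (- q * B))"
      by (rule t_lift) simp
    have d2: "pdvd (N + 3) (\<Sum>j\<in>{N + 2..<p}. t j)"
    proof (rule pdvd_sum)
      fix j assume "j \<in> {N + 2..<p}"
      then show "pdvd (N + 3) (t j)"
        using that by (cases "j = N + 2") (auto intro: t_dvd t_dvd')
    qed
    have "{N + 1..<p} = insert (N + 1) {N + 2..<p}" using that by auto
    then have "E = t (N + 1) + (\<Sum>j\<in>{N + 2..<p}. t j)"
      using E_tail that by simp
    moreover have "b (N + 1) * q ^ (N + 1) * (- q * B) = x2 * q ^ (N + 2)"
      by (simp add: x2)
    ultimately have "E - x2 * q ^ (N + 2) = (t (N + 1) - b (N + 1) * q ^ (N + 1) * (- q * B))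
        + (\<Sum>j\<in>{N + 2..<p}. t j)"
      by simp
    then show "pdvd (N + 3) (E - x2 * q ^ (N + 2))"
      using pdvd_add[OF d1 d2] by simp
  qed

  have top: "pdvd 1 (H (p - 1) - (- 1))"
    using elem_harmonic_top by (simp add: H_def)

  have 3: "pdvd (N + 3) (E - x3 * q ^ (N + 2)) \<and> p_integral p x3" if "N + 3 = p"
  proof
    show "p_integral p x3"
      unfolding x3_def using that bi half by (intro p_integral_diff) auto
    have pe: "p - 1 = N + 2" using that by simp
    have d2: "pdvd (N + 3) (t (N + 2) - b (N + 2) * q ^ (N + 2) * (- 1))"
      using top unfolding pe by (rule t_lift) simp
    \<comment> \<open>The index N + 1 = p - 2 lies outside the range of
      \<open>elem_harmonic_odd\<close>. The reflection relation has at most two nonzero summands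
      here and yields the exact identity \<open>H1\<close>.\<close>
    define r where "r i = (-1) ^ i * of_nat (i choose (N + 1)) * (q ^ i * H i)" for i
    have even: "even N" using that p(2) by (metis even_add odd_numeral)
    have "{..<p} = insert (N + 2) (insert (N + 1) {..<N + 1})" using that by auto
    then have "(\<Sum>i<p. r i) = r (N + 2) + (r (N + 1) + (\<Sum>i<N + 1. r i))" by simp
    moreover have "(\<Sum>i<N + 1. r i) = 0" by (rule sum.neutral) (simp add: r_def binomial_eq_0)
    moreover have "r (N + 1) = - (q ^ (N + 1) * H (N + 1))" using even by (simp add: r_def)
    moreover have "r (N + 2) = of_nat (N + 2) * (q ^ (N + 2) * H (N + 2))" using even by (simp add: r_def)
    moreover have "q ^ (N + 1) * H (N + 1) = (\<Sum>i<p. r i)"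
      unfolding r_def q_def H_def by (rule elem_harmonic_symmetry[OF p(2)])
    ultimately have "2 * (q ^ (N + 1) * H (N + 1)) = of_nat (N + 2) * (q ^ (N + 2) * H (N + 2))"
      by linarith
    then have "q ^ (N + 1) * (2 * H (N + 1)) = q ^ (N + 1) * (q * of_nat (N + 2) * H (N + 2))"
      by (simp add: mult_ac)
    moreover have "q \<noteq> 0" using p_pos by (simp add: q_def)
    ultimately have H1: "2 * H (N + 1) = q * of_nat (N + 2) * H (N + 2)" by simp
    have "of_nat (N + 2) = q - 1" using that by (simp add: q_def flip: that)
    then have "2 * H (N + 1) = q * (q - 1) * H (N + 2)" using H1 by simp
    \<comment> \<open>Since H (p - 1) \<equiv> -1 modulo p, the bracket on the right is a multiple
      of p, so H (p - 2) \<equiv> p / 2 modulo p^2.\<close>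
    then have "H (N + 1) - q / 2 = q * (q * H (N + 2) - (H (N + 2) - - 1)) / of_nat 2"
      by (simp add: algebra_simps)
    moreover have "pdvd 2 (q * (q * H (N + 2) - (H (N + 2) - - 1)) / of_nat 2)"
    proof -
      have q1: "pdvd 1 q" using pdvd_power[of 1] by (simp add: q_def)
      have "pdvd 1 (q * H (N + 2))" using Hi by (intro pdvdI[of "H (N + 2)"]) (simp_all add: q_def)
      from pdvd_mult[OF q1 pdvd_diff[OF this top[unfolded pe]]]
      show ?thesis using that by (intro pdvd_divide_nat not_dvd_less) (simp_all add: numeral_2_eq_2)
    qed
    ultimately have "pdvd 2 (H (N + 1) - q / 2)" by (simp only:)
    then have d1: "pdvd (N + 3) (t (N + 1) - b (N + 1) * q ^ (N + 1) * (q / 2))"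
      by (rule t_lift) simp
    have "{N + 1..<p} = {N + 1, N + 2}" using that by auto
    then have "E = t (N + 1) + t (N + 2)" using E_tail that by simp
    then have "E - x3 * q ^ (N + 2) = (t (N + 1) - b (N + 1) * q ^ (N + 1) * (q / 2))
        + (t (N + 2) - b (N + 2) * q ^ (N + 2) * (- 1))"
      by (simp add: x3_def algebra_simps)
    then show "pdvd (N + 3) (E - x3 * q ^ (N + 2))" using pdvd_add[OF d1 d2] by simp
  qed

  \<comment> \<open>Only the term j = p - 1 remains, and H (p - 1) \<equiv> -1 modulo p.\<close>
  have 4: "pdvd (N + 2) (E - x4 * q ^ (N + 1)) \<and> p_integral p x4" if "N + 2 = p"
  proof
    show "p_integral p x4" unfolding x4_def using bi by auto
    have pe: "p - 1 = N + 1" using that by simp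
    have "{N + 1..<p} = {N + 1}" using that by auto
    then have "E = t (N + 1)" using E_tail that by simp
    moreover have "pdvd (N + 2) (t (N + 1) - b (N + 1) * q ^ (N + 1) * (- 1))"
      using top unfolding pe by (rule t_lift) simp
    ultimately show "pdvd (N + 2) (E - x4 * q ^ (N + 1))"
      by (simp add: x4_def)
  qed

  have r1: "rat_cong p (N + 4) E (x1 * q ^ (N + 3)) \<and>
      rat_cong p (N + 3) (of_int (k * int p - 1) gchoose (p - 1)) S" if "N + 4 \<le> p \<and> even N"
    using 1 that strong[of "N + 4" x1 "N + 3"] weaken[of "N + 4" x1 "N + 3"] by simp
  have r2: "rat_cong p (N + 3) E (x2 * q ^ (N + 2)) \<and>
      rat_cong p (N + 2) (of_int (k * int p - 1) gchoose (p - 1)) S" if "N + 4 \<le> p \<and> odd N"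
    using 2 that strong[of "N + 3" x2 "N + 2"] weaken[of "N + 3" x2 "N + 2"] by simp
  have r3: "rat_cong p (N + 3) E (x3 * q ^ (N + 2)) \<and>
      rat_cong p (N + 2) (of_int (k * int p - 1) gchoose (p - 1)) S" if "N + 3 = p"
    using 3 that strong[of "N + 3" x3 "N + 2"] weaken[of "N + 3" x3 "N + 2"] by simp
  have r4: "rat_cong p (N + 2) E (x4 * q ^ (N + 1)) \<and>
      rat_cong p (N + 1) (of_int (k * int p - 1) gchoose (p - 1)) S" if "N + 2 = p"
    using 4 that strong[of "N + 2" x4 "N + 1"] weaken[of "N + 2" x4 "N + 1"] by simp
  have "(of_int (k * int p - 1) gchoose (p - 1)) = S" if "p \<le> N + 1"
    using exact[OF that] E by simp
  then show ?thesis
    unfolding x1_def[symmetric] x2_def[symmetric] x3_def[symmetric] x4_def[symmetric] q_def[symmetric]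
    using r1 r2 r3 r4 exact by blast
qed

end
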